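(* The mixed-no-purchase multinomial logit (mixed-NP-MNL) model is a convex chain decomposable (CCD) choice model. Explicitly: for every mixed-NP-MNL model $\pi$ on products $\mathcal N=\{1,\dots,n\}$, every $T\ge 0$ and every family of weights $\{h(A)\}_{A\subseteq\mathcal N}$ with $h(A)\ge0$ and $\sum_{A\subseteq\mathcal N}h(A)=T$, if $\phi\in\mathbb R_+^n$ is defined by $\phi_i=\sum_{A\subseteq\mathcal N}h(A)\,\pi(i,A)$, then the stockout time $\tau_i(\phi)$ of every product $i\in\mathcal N$ in the fluid show-all process started from inventory vector $\phi$ over an infinite horizon satisfies $\tau_i(\phi)\in[0,T]$.
   Context: Mixed-NP-MNL model. There is a finite set $\mathcal G$ of customer types with arrival probabilities $\lambda_g\ge0$, $\sum_g\lambda_g\le1$; product weights $w_i>0$ common to all types; and type-specific no-purchase weights $w_{0,g}>0$. For $A\subseteq\mathcal N$ let $w(A)=\sum_{j\in A}w_j$. The choice probability of $i\in A$ is $\pi(i,A)=\sum_{g\in\mathcal G}\lambda_g\,\dfrac{w_i}{w_{0,g}+w(A)}$, and $\pi(i,A)=0$ if $i\notin A$. Fluid show-all process. Starting from a real inventory vector $\phi\in\mathbb R_+^n$, at every moment of continuous time the displayed assortment $A$ is the set of all products with positive remaining inventory, and the inventory of each $i\in A$ is consumed at rate $\pi(i,A)$; a product leaves the displayed assortment as soon as its inventory reaches zero. The stockout time $\tau_i(\phi)$ is the first moment at which product $i$ has zero inventory (so it is $0$ if $\phi_i=0$). CCD. A choice model $\pi$ on $\mathcal N$ is CCD if, for every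 $T$ and every $h\ge0$ with $\sum_{A\subseteq\mathcal N}h(A)=T$, the vector $\phi$ with $\phi_i=\sum_A h(A)\pi(i,A)$ satisfies $\tau_i(\phi)\in[0,T]$ for all $i$. *)

theory Defs
  imports "HOL-Analysis.Analysis"
begin

text \<open>
  A choice model on a finite set of products \<open>N\<close> is a function \<open>\<pi>\<close>, where \<open>\<pi> i A\<close> is the
  probability that the next customer buys \<open>i\<close> when the assortment \<open>A \<subseteq> N\<close> is on display.
\<close>

definition mixed_np_mnl ::
  "'g set \<Rightarrow> ('g \<Rightarrow> real) \<Rightarrow> ('i \<Rightarrow> real) \<Rightarrow> ('g \<Rightarrow> real) \<Rightarrow> 'i \<Rightarrow> 'i set \<Rightarrow> real"
  where "mixed_np_mnl G lam w w0 i A =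
    (if i \<in> A then \<Sum>g\<in>G. lam g * (w i / (w0 g + (\<Sum>j\<in>A. w j))) else 0)"

definition displayed :: "'i set \<Rightarrow> ('i \<Rightarrow> real) \<Rightarrow> 'i set"
  where "displayed N v = {i \<in> N. v i > 0}"

text \<open>
  \<open>x t i\<close> is the inventory of product \<open>i\<close> at time \<open>t\<close>.  The rate of consumption jumps at
  stockouts, so the dynamics are stated in integral form: up to every time \<open>t \<ge> 0\<close> the amount
  consumed of \<open>i\<close> is the integral of its consumption rate.  The values of \<open>x\<close> at negative times
  or outside \<open>N\<close> are irrelevant.
\<close>

definition fluid_show_all ::
  "'i set \<Rightarrow> ('i \<Rightarrow> 'i set \<Rightarrow> real) \<Rightarrow> ('i \<Rightarrow> real) \<Rightarrow> (real \<Rightarrow> 'i \<Rightarrow> real) \<Rightarrow> bool"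
  where "fluid_show_all N \<pi> \<phi> x \<longleftrightarrow>
    (\<forall>t\<ge>0. \<forall>i\<in>N. ((\<lambda>s. \<pi> i (displayed N (x s))) has_integral (\<phi> i - x t i)) {0..t})"

text \<open>
  For choice models and nonnegative \<open>\<phi>\<close> the trajectory exists and is unique for times \<open>t \<ge> 0\<close> and
  products in \<open>N\<close>; see \<open>fluid_show_all_exists\<close> and \<open>fluid_show_all_unique\<close> below.
\<close>

definition fluid_inventory ::
  "'i set \<Rightarrow> ('i \<Rightarrow> 'i set \<Rightarrow> real) \<Rightarrow> ('i \<Rightarrow> real) \<Rightarrow> real \<Rightarrow> 'i \<Rightarrow> real"
  where "fluid_inventory N \<pi> \<phi> = (SOME x. fluid_show_all N \<pi> \<phi> x)"

text \<open>
  A product that never stocks out has stockout time \<open>\<infinity>\<close>, the infimum of the empty set in \<open>ereal\<close>.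
\<close>

definition stockout_time ::
  "'i set \<Rightarrow> ('i \<Rightarrow> 'i set \<Rightarrow> real) \<Rightarrow> ('i \<Rightarrow> real) \<Rightarrow> 'i \<Rightarrow> ereal"
  where "stockout_time N \<pi> \<phi> i = (INF t \<in> {t. t \<ge> 0 \<and> fluid_inventory N \<pi> \<phi> t i = 0}. ereal t)"

definition CCD :: "'i set \<Rightarrow> ('i \<Rightarrow> 'i set \<Rightarrow> real) \<Rightarrow> bool"
  where "CCD N \<pi> \<longleftrightarrow>
    (\<forall>T h. (\<forall>A\<in>Pow N. h A \<ge> 0) \<and> (\<Sum>A\<in>Pow N. h A) = T \<longrightarrow>
      (\<forall>i\<in>N. stockout_time N \<pi> (\<lambda>j. \<Sum>A\<in>Pow N. h A * \<pi> j A) i \<in> {0..ereal T}))"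

subsection \<open>Well-definedness of the fluid show-all process\<close>

lemma fluid_show_all_exists:
  assumes fin: "finite N"
    and nonneg: "\<And>A i. A \<subseteq> N \<Longrightarrow> i \<in> N \<Longrightarrow> \<pi> i A \<ge> 0"
    and zero: "\<And>A i. A \<subseteq> N \<Longrightarrow> i \<in> N - A \<Longrightarrow> \<pi> i A = 0"
    and "\<And>i. i \<in> N \<Longrightarrow> \<phi> i \<ge> 0"
  shows "\<exists>x. fluid_show_all N \<pi> \<phi> x"
  using assms(4)
proof (induction "card (displayed N \<phi>)" arbitrary: \<phi> rule: less_induct)
  case less
  define A where "A = displayed N \<phi>"
  have AN: "A \<subseteq> N" "finite A" using fin by (auto simp: A_def displayed_def)
  show ?case
  proof (cases "\<forall>i\<in>N. \<pi> i A = 0")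
    case True
    then have "fluid_show_all N \<pi> \<phi> (\<lambda>_. \<phi>)"
      by (simp add: fluid_show_all_def A_def has_integral_is_0)
    then show ?thesis by blast
  next
    case False
    define B where "B = {i\<in>N. \<pi> i A > 0}"
    have B: "finite B" "B \<noteq> {}" "B \<subseteq> A"
      using False fin nonneg[OF AN(1)] zero[OF AN(1)] by (force simp: B_def less_le)+
    define s where "s = Min ((\<lambda>i. \<phi> i / \<pi> i A) ` B)"
    have "s \<in> (\<lambda>i. \<phi> i / \<pi> i A) ` B" unfolding s_def using B by (intro Min_in) auto
    then obtain k where k: "k \<in> B" "s = \<phi> k / \<pi> k A" by blast
    have kA: "k \<in> A" using k B by auto
    have spos: "s > 0"
      using k kA by (auto simp: B_def A_def displayed_def)
    have sle: "s * \<pi> i A \<le> \<phi> i" if "i \<in> N" for i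
    proof (cases "i \<in> B")
      case True
      then have "s \<le> \<phi> i / \<pi> i A" unfolding s_def using B by (intro Min_le) auto
      then show ?thesis using True by (simp add: B_def field_simps)
    next
      case False
      then have "\<pi> i A = 0" using that nonneg[OF AN(1) that] by (auto simp: B_def)
      then show ?thesis using less.prems[OF that] by simp
    qed
    define \<psi> where "\<psi> i = \<phi> i - s * \<pi> i A" for i
    have \<psi>: "\<psi> i \<ge> 0" if "i \<in> N" for i using sle[OF that] by (simp add: \<psi>_def)
    have "displayed N \<psi> \<subset> A"
    proof
      show "displayed N \<psi> \<subseteq> A"
      proof
        fix i assume i: "i \<in> displayed N \<psi>"
        then have "0 \<le> s * \<pi> i A" using spos nonneg[OF AN(1)] by (simp add: displayed_def)
        then show "i \<in> A" using i by (auto simp: displayed_def A_def \<psi>_def)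
      qed
      have "\<psi> k = 0" using k by (auto simp: \<psi>_def B_def)
      then show "displayed N \<psi> \<noteq> A" using kA by (auto simp: displayed_def)
    qed
    then have "card (displayed N \<psi>) < card (displayed N \<phi>)"
      using AN(2) psubset_card_mono A_def by blast
    from less.hyps[OF this \<psi>] obtain y where y: "fluid_show_all N \<pi> \<psi> y" by blast
    define x where "x t i = (if t < s then \<phi> i - t * \<pi> i A else y (t - s) i)" for t i
    have disp: "displayed N (x t) = A" if "0 \<le> t" "t < s" for t
    proof -
      have "\<phi> i - t * \<pi> i A > 0 \<longleftrightarrow> \<phi> i > 0" if "i \<in> N" for i
      proof
        assume "\<phi> i - t * \<pi> i A > 0"
        moreover have "t * \<pi> i A \<ge> 0" using \<open>0 \<le> t\<close> nonneg[OF AN(1) that] by simp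
        ultimately show "\<phi> i > 0" by linarith
      next
        assume p: "\<phi> i > 0"
        show "\<phi> i - t * \<pi> i A > 0"
        proof (cases "\<pi> i A = 0")
          case False
          then have "t * \<pi> i A < s * \<pi> i A"
            using \<open>t < s\<close> nonneg[OF AN(1) that] by simp
          then show ?thesis using sle[OF that] by linarith
        qed (use p in simp)
      qed
      then show ?thesis using that by (auto simp: displayed_def x_def A_def)
    qed
    have first: "((\<lambda>r. \<pi> i (displayed N (x r))) has_integral t * \<pi> i A) {0..t}"
      if "0 \<le> t" "t \<le> s" for t i
    proof (rule has_integral_spike_finite[of "{s}"])
      show "((\<lambda>_. \<pi> i A) has_integral t * \<pi> i A) {0..t}"
        using has_integral_const_real[of "\<pi> i A" 0 t] that by simp
    qed (use that disp in auto)
    have "fluid_show_all N \<pi> \<phi> x"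
      unfolding fluid_show_all_def
    proof (intro allI impI ballI)
      fix t :: real and i assume t: "t \<ge> 0" and i: "i \<in> N"
      show "((\<lambda>r. \<pi> i (displayed N (x r))) has_integral \<phi> i - x t i) {0..t}"
      proof (cases "t < s")
        case True
        then show ?thesis using first[of t i] t by (simp add: x_def)
      next
        case False
        have "((\<lambda>r. \<pi> i (displayed N (y r))) has_integral \<psi> i - y (t - s) i) {0..t - s}"
          using y i False by (simp add: fluid_show_all_def)
        moreover have "(\<lambda>r. \<pi> i (displayed N (x r))) (s + r) = \<pi> i (displayed N (y r))"
          if "r \<in> {0..t - s}" for r
          using that by (simp add: x_def[abs_def])
        ultimately have
          "(((\<lambda>r. \<pi> i (displayed N (x r))) \<circ> (+) s) has_integral \<psi> i - y (t - s) i) {0..t - s}"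
          by (subst has_integral_cong[where g = "\<lambda>r. \<pi> i (displayed N (y r))"]) auto
        then have "((\<lambda>r. \<pi> i (displayed N (x r))) has_integral \<psi> i - y (t - s) i) {s..t}"
          unfolding has_integral_shift_Icc_real by simp
        from has_integral_combine[OF _ _ first this] show ?thesis
          using False spos by (simp add: x_def \<psi>_def)
      qed
    qed
    then show ?thesis by blast
  qed
qed

context
  fixes N :: "'i set" and \<pi> :: "'i \<Rightarrow> 'i set \<Rightarrow> real" and \<phi> :: "'i \<Rightarrow> real"
  assumes fin: "finite N"
    and nonneg: "\<And>A i. A \<subseteq> N \<Longrightarrow> i \<in> N \<Longrightarrow> \<pi> i A \<ge> 0"
    and zero: "\<And>A i. A \<subseteq> N \<Longrightarrow> i \<in> N - A \<Longrightarrow> \<pi> i A = 0"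
    and init: "\<And>i. i \<in> N \<Longrightarrow> \<phi> i \<ge> 0"
begin

lemma fluid_show_all_increment:
  assumes x: "fluid_show_all N \<pi> \<phi> x" and i: "i \<in> N" and st: "0 \<le> s" "s \<le> t"
  shows "((\<lambda>r. \<pi> i (displayed N (x r))) has_integral x s i - x t i) {s..t}"
proof -
  let ?f = "\<lambda>r. \<pi> i (displayed N (x r))"
  have s: "(?f has_integral \<phi> i - x s i) {0..s}" and t: "(?f has_integral \<phi> i - x t i) {0..t}"
    using x i st by (auto simp: fluid_show_all_def)
  have "?f integrable_on {s..t}"
    by (rule integrable_subinterval_real[OF has_integral_integrable[OF t]]) (use st in simp)
  then have st': "(?f has_integral integral {s..t} ?f) {s..t}" by (rule integrable_integral)
  have "\<phi> i - x s i + integral {s..t} ?f = \<phi> i - x t i"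
    using has_integral_unique[OF has_integral_combine[OF st s st'] t] .
  then have "integral {s..t} ?f = x s i - x t i" by simp
  then show ?thesis using st' by simp
qed

lemma fluid_show_all_antimono:
  assumes x: "fluid_show_all N \<pi> \<phi> x" and i: "i \<in> N" and st: "0 \<le> s" "s \<le> t"
  shows "x t i \<le> x s i"
proof -
  have "0 \<le> \<pi> i (displayed N (x r))" for r
    using i by (intro nonneg) (auto simp: displayed_def)
  then have "0 \<le> x s i - x t i"
    by (rule has_integral_nonneg[OF fluid_show_all_increment[OF assms]])
  then show ?thesis by simp
qed

lemma fluid_show_all_continuous:
  assumes x: "fluid_show_all N \<pi> \<phi> x" and i: "i \<in> N"
  shows "continuous_on {0..t} (\<lambda>s. x s i)"
proof (cases "0 \<le> t")
  case True
  let ?f = "\<lambda>r. \<pi> i (displayed N (x r))"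
  have h: "(?f has_integral \<phi> i - x s i) {0..s}" if "0 \<le> s" for s
    using x i that by (auto simp: fluid_show_all_def)
  have "continuous_on {0..t} (\<lambda>s. \<phi> i - integral {0..s} ?f)"
    using has_integral_integrable[OF h[OF True]]
    by (intro continuous_on_diff continuous_on_const indefinite_integral_continuous_1)
  moreover have "\<phi> i - integral {0..s} ?f = x s i" if "s \<in> {0..t}" for s
    using integral_unique[OF h[of s]] that by simp
  ultimately show ?thesis by (rule continuous_on_eq)
qed simp

lemma fluid_show_all_0:
  assumes x: "fluid_show_all N \<pi> \<phi> x" and i: "i \<in> N"
  shows "x 0 i = \<phi> i"
proof -
  have "((\<lambda>r. \<pi> i (displayed N (x r))) has_integral \<phi> i - x 0 i) {0..0}"
    using x i by (auto simp: fluid_show_all_def)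
  moreover have "((\<lambda>r. \<pi> i (displayed N (x r))) has_integral 0) {0..0}"
    by (metis has_integral_refl(2) atLeastAtMost_singleton)
  ultimately have "\<phi> i - x 0 i = 0" by (rule has_integral_unique)
  then show ?thesis by simp
qed

lemma fluid_show_all_nonneg:
  assumes x: "fluid_show_all N \<pi> \<phi> x" and i: "i \<in> N" and t: "0 \<le> t"
  shows "x t i \<ge> 0"
proof (rule ccontr)
  assume neg: "\<not> x t i \<ge> 0"
  have "\<exists>r\<ge>0. r \<le> t \<and> x r i = 0"
    using IVT2'[of "\<lambda>s. x s i" t 0 0] neg t fluid_show_all_0[OF x i] init[OF i]
      fluid_show_all_continuous[OF x i, of t] by simp
  then obtain r where r: "0 \<le> r" "r \<le> t" "x r i = 0" by blast
  have "\<pi> i (displayed N (x s)) = 0" if "s \<in> {r..t}" for s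
  proof -
    have "x s i \<le> 0" using fluid_show_all_antimono[OF x i r(1), of s] that r by simp
    then show ?thesis using i by (intro zero) (auto simp: displayed_def)
  qed
  then have "((\<lambda>s. \<pi> i (displayed N (x s))) has_integral 0) {r..t}"
    by (intro has_integral_is_0) auto
  with fluid_show_all_increment[OF x i r(1,2)] have "x r i - x t i = 0"
    by (rule has_integral_unique)
  then show False using r neg by simp
qed

lemma fluid_show_all_locally_constant:
  assumes x: "fluid_show_all N \<pi> \<phi> x" and u: "0 \<le> u"
  shows "eventually (\<lambda>s. displayed N (x s) = displayed N (x u)) (at_right u)"
proof -
  have "eventually (\<lambda>s. (x s i > 0) = (x u i > 0)) (at_right u)" if i: "i \<in> N" for i
  proof (cases "x u i > 0")
    case True
    have "continuous_on {u..u+1} (\<lambda>s. x s i)"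
      by (rule continuous_on_subset[OF fluid_show_all_continuous[OF x i, of "u + 1"]]) (use u in auto)
    then have "((\<lambda>s. x s i) \<longlongrightarrow> x u i) (at_right u)"
      by (rule continuous_on_Icc_at_rightD) simp
    then have "eventually (\<lambda>s. x s i > 0) (at_right u)"
      using True by (rule order_tendstoD)
    then show ?thesis using True by simp
  next
    case False
    have "x s i \<le> 0" if "s > u" for s
      using fluid_show_all_antimono[OF x i u, of s] that False by simp
    with False have "(x s i > 0) = (x u i > 0)" if "s \<in> {u<..<u + 1}" for s
      using that by force
    moreover have "u < u + 1" by simp
    ultimately show ?thesis by (rule eventually_at_rightI)
  qed
  then have "eventually (\<lambda>s. \<forall>i\<in>N. (x s i > 0) = (x u i > 0)) (at_right u)"
    using fin by (simp add: eventually_ball_finite)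
  then show ?thesis by eventually_elim (auto simp: displayed_def)
qed

lemma fluid_show_all_unique:
  assumes x: "fluid_show_all N \<pi> \<phi> x" and y: "fluid_show_all N \<pi> \<phi> y"
    and t: "0 \<le> t" and i: "i \<in> N"
  shows "x t i = y t i"
proof (rule ccontr)
  assume ne: "x t i \<noteq> y t i"
  define S where "S = {t. 0 \<le> t \<and> (\<exists>i\<in>N. x t i \<noteq> y t i)}"
  define u where "u = Inf S"
  have S: "t \<in> S" "bdd_below S" using ne t i by (auto simp: S_def intro: bdd_belowI[of _ 0])
  have u0: "0 \<le> u" unfolding u_def using S by (intro cInf_greatest) (auto simp: S_def)
  have before: "x r j = y r j" if "0 \<le> r" "r < u" "j \<in> N" for r j
    using that cInf_lower[OF _ S(2), of r] by (force simp: S_def u_def)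
  have at_u: "x u j = y u j" if j: "j \<in> N" for j
  proof -
    have "((\<lambda>r. \<pi> j (displayed N (y r))) has_integral \<phi> j - x u j) {0..u}"
    proof (rule has_integral_spike_finite[of "{u}"])
      show "((\<lambda>r. \<pi> j (displayed N (x r))) has_integral \<phi> j - x u j) {0..u}"
        using x j u0 by (auto simp: fluid_show_all_def)
      fix r assume "r \<in> {0..u} - {u}"
      then have "displayed N (y r) = displayed N (x r)" using before[of r] by (auto simp: displayed_def)
      then show "\<pi> j (displayed N (y r)) = \<pi> j (displayed N (x r))" by simp
    qed simp
    moreover have "((\<lambda>r. \<pi> j (displayed N (y r))) has_integral \<phi> j - y u j) {0..u}"
      using y j u0 by (auto simp: fluid_show_all_def)
    ultimately have "\<phi> j - x u j = \<phi> j - y u j" by (rule has_integral_unique)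
    then show ?thesis by simp
  qed
  then have du: "displayed N (x u) = displayed N (y u)" by (auto simp: displayed_def)
  have "eventually (\<lambda>s. displayed N (x s) = displayed N (y s)) (at_right u)"
    using fluid_show_all_locally_constant[OF x u0] fluid_show_all_locally_constant[OF y u0]
    by eventually_elim (simp add: du)
  then obtain b where b: "b > u" "\<And>s. u < s \<Longrightarrow> s < b \<Longrightarrow> displayed N (x s) = displayed N (y s)"
    by (auto simp: eventually_at_right_field)
  have after: "x r j = y r j" if "u \<le> r" "r < b" "j \<in> N" for r j
  proof -
    have "((\<lambda>s. \<pi> j (displayed N (x s))) has_integral y u j - y r j) {u..r}"
      by (rule has_integral_eq[OF _ fluid_show_all_increment[OF y that(3) u0 that(1)]])
        (use du b that in \<open>auto simp: le_less\<close>)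
    with fluid_show_all_increment[OF x that(3) u0 that(1)]
    have "x u j - x r j = y u j - y r j" by (rule has_integral_unique)
    then show ?thesis using at_u[OF that(3)] by simp
  qed
  have "r \<ge> b" if "r \<in> S" for r
    using that before[of r] after[of r] by (force simp: S_def)
  then have "b \<le> u" unfolding u_def using S by (intro cInf_greatest) auto
  then show False using b by simp
qed

end

lemma mixed_np_mnl_nonneg:
  assumes "finite N" "A \<subseteq> N"
    and "\<And>g. g \<in> G \<Longrightarrow> lam g \<ge> 0" "\<And>j. j \<in> N \<Longrightarrow> w j > 0" "\<And>g. g \<in> G \<Longrightarrow> w0 g > 0"
  shows "mixed_np_mnl G lam w w0 i A \<ge> 0"
proof -
  have w: "w j \<ge> 0" if "j \<in> A" for j
    using that assms(2,4) by (meson less_imp_le subsetD)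
  then have "(\<Sum>j\<in>A. w j) \<ge> 0" by (rule sum_nonneg)
  then show ?thesis
    using w assms(3,5) by (auto simp: mixed_np_mnl_def less_imp_le intro!: sum_nonneg mult_nonneg_nonneg divide_nonneg_nonneg)
qed

lemma mixed_np_mnl_notin: "i \<notin> A \<Longrightarrow> mixed_np_mnl G lam w w0 i A = 0"
  by (simp add: mixed_np_mnl_def)

end

theory Submission
  imports Defs
begin

text \<open>
  Write \<open>\<pi>(i, A) = w\<^sub>i f(w(A))\<close> with \<open>f(x) = \<Sum>\<^sub>g \<lambda>\<^sub>g / (w\<^sub>0\<^sub>g + x)\<close>.  By Cauchy--Schwarz \<open>1/f\<close> is concave,
  so \<open>\<gamma>(A) = 1 / f(w(A))\<close> with \<open>\<gamma>(\<emptyset>) = 0\<close> is monotone and submodular.  The sets displayed over time form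
  a chain, and the greedy algorithm gives \<open>y \<ge> 0\<close> with \<open>y(A) \<le> \<gamma>(A)\<close> for all \<open>A\<close> and equality along
  the chain.  The potential \<open>\<Sum>\<^sub>j y\<^sub>j x\<^sub>j / w\<^sub>j\<close> then decreases at rate
  \<open>f(w(A)) y(A) = 1\<close> while anything is displayed, and it starts at
  \<open>\<Sum>\<^sub>A h(A) f(w(A)) y(A) \<le> T\<close>; so nothing can be left at time \<open>T\<close>.
\<close>

section \<open>Greedy vectors of a monotone submodular function\<close>

text \<open>Edmonds' greedy construction, by induction on \<open>N\<close>: delete an element
  \<open>k\<close> avoided by every member of the chain other than \<open>N\<close>, solve the rest,
  and give \<open>k\<close> its marginal value over \<open>N - {k}\<close>. By submodularity this is
  its least marginal value, so the upper bounds survive; monotonicity makes it nonnegative.\<close>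

lemma submodular_greedy_chain:
  fixes \<gamma> :: "'i set \<Rightarrow> real"
  assumes "finite N" and empty: "\<gamma> {} = 0"
    and "\<And>A B. A \<subseteq> B \<Longrightarrow> B \<subseteq> N \<Longrightarrow> \<gamma> A \<le> \<gamma> B"
    and "\<And>A B k. A \<subseteq> B \<Longrightarrow> B \<subseteq> N \<Longrightarrow> k \<in> N - B \<Longrightarrow>
      \<gamma> (insert k B) - \<gamma> B \<le> \<gamma> (insert k A) - \<gamma> A"
    and "C \<subseteq> Pow N" and "\<And>X Y. X \<in> C \<Longrightarrow> Y \<in> C \<Longrightarrow> X \<subseteq> Y \<or> Y \<subseteq> X"
  shows "\<exists>y. (\<forall>j\<in>N. y j \<ge> 0) \<and> (\<forall>A\<subseteq>N. sum y A \<le> \<gamma> A) \<and> (\<forall>X\<in>C. sum y X = \<gamma> X)"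
  using assms(1,3-)
proof (induction N arbitrary: C rule: finite_psubset_induct)
  case (psubset N)
  note mono = psubset.prems(1) and submod = psubset.prems(2)
    and CN = psubset.prems(3) and chain = psubset.prems(4)
  show ?case
  proof (cases "N = {}")
    case True
    then show ?thesis using empty CN by (intro exI[of _ "\<lambda>_. 0"]) auto
  next
    case False
    \<comment> \<open>A nonempty finite chain contains its own union, so the members other than
      \<open>N\<close> do not cover \<open>N\<close>; an uncovered element serves as
      \<open>k\<close>.\<close>
    have "\<Union>(C - {N}) \<noteq> N"
    proof (cases "C - {N} = {}")
      case False
      have "finite (C - {N})"
        using CN psubset.hyps by (meson finite_Diff finite_Pow_iff finite_subset)
      moreover have "subset.chain UNIV (C - {N})"
        using chain by (auto simp: subset_chain_def)
      ultimately have "\<Union>(C - {N}) \<in> C - {N}"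
        using False by (intro Union_in_chain)
      then show ?thesis by blast
    qed (use False in auto)
    moreover have "\<Union>(C - {N}) \<subseteq> N" using CN by auto
    ultimately obtain k where k: "k \<in> N" "\<And>X. X \<in> C - {N} \<Longrightarrow> k \<notin> X" by blast
    define M where "M = N - {k}"
    have N: "N = insert k M" "k \<notin> M" "finite M" using k psubset.hyps by (auto simp: M_def)
    have CM: "C - {N} \<subseteq> Pow M"
      using CN k(2) by (force simp: M_def)
    \<comment> \<open>\<open>M\<close> joins the chain so that \<open>sum y M = \<gamma> M\<close>;
      the sum of \<open>z\<close> over \<open>N\<close> then telescopes to
      \<open>\<gamma> N\<close>.\<close>
    have "\<exists>y. (\<forall>j\<in>M. y j \<ge> 0) \<and> (\<forall>A\<subseteq>M. sum y A \<le> \<gamma> A) \<and>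
        (\<forall>X\<in>insert M (C - {N}). sum y X = \<gamma> X)"
    proof (rule psubset.IH)
      show "M \<subset> N" using N by auto
      show "insert M (C - {N}) \<subseteq> Pow M" using CM by auto
      show "\<gamma> A \<le> \<gamma> B" if "A \<subseteq> B" "B \<subseteq> M" for A B
        using that N by (intro mono) auto
      show "\<gamma> (insert i B) - \<gamma> B \<le> \<gamma> (insert i A) - \<gamma> A"
        if "A \<subseteq> B" "B \<subseteq> M" "i \<in> M - B" for A B i
        using that N by (intro submod) auto
      show "X \<subseteq> Y \<or> Y \<subseteq> X" if "X \<in> insert M (C - {N})" "Y \<in> insert M (C - {N})" for X Y
        using that CM chain by blast
    qed
    then obtain y where y: "\<And>j. j \<in> M \<Longrightarrow> y j \<ge> 0" "\<And>A. A \<subseteq> M \<Longrightarrow> sum y A \<le> \<gamma> A"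
      "\<And>X. X \<in> insert M (C - {N}) \<Longrightarrow> sum y X = \<gamma> X" by blast
    define z where "z = y(k := \<gamma> N - \<gamma> M)"
    have zM: "sum z A = sum y A" if "A \<subseteq> M" for A
      using that N by (intro sum.cong) (auto simp: z_def)
    have zk: "sum z (insert k A) = \<gamma> N - \<gamma> M + sum y A" if "A \<subseteq> M" for A
    proof -
      have "finite A" "k \<notin> A" using that N finite_subset by auto
      then show ?thesis using zM[OF that] by (simp add: z_def)
    qed
    have "z j \<ge> 0" if "j \<in> N" for j
      using that y(1)[of j] mono[of M N] N by (auto simp: z_def)
    moreover have "sum z A \<le> \<gamma> A" if A: "A \<subseteq> N" for A
    proof (cases "k \<in> A")
      case True
      then obtain B where B: "A = insert k B" "k \<notin> B" by (meson mk_disjoint_insert)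
      have BM: "B \<subseteq> M" using A B N by auto
      have "\<gamma> N - \<gamma> M \<le> \<gamma> A - \<gamma> B"
        using submod[of B M k] BM N B by auto
      then show ?thesis using zk[OF BM] y(2)[OF BM] B by simp
    next
      case False
      then have "A \<subseteq> M" using A N by auto
      then show ?thesis using zM y(2) by simp
    qed
    moreover have "sum z X = \<gamma> X" if "X \<in> C" for X
    proof (cases "X = N")
      case True
      then show ?thesis using zk[of M] y(3)[of M] N by simp
    next
      case False
      then show ?thesis using that CM zM[of X] y(3)[of X] by auto
    qed
    ultimately show ?thesis by blast
  qed
qed

section \<open>The attraction function and concavity of its reciprocal\<close>

definition attraction :: "'g set \<Rightarrow> ('g \<Rightarrow> real) \<Rightarrow> ('g \<Rightarrow> real) \<Rightarrow> real \<Rightarrow> real"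
  where "attraction G lam w0 x = (\<Sum>g\<in>G. lam g / (w0 g + x))"

lemma mixed_np_mnl_attraction:
  "i \<in> A \<Longrightarrow> mixed_np_mnl G lam w w0 i A = w i * attraction G lam w0 (sum w A)"
  by (simp add: mixed_np_mnl_def attraction_def sum_distrib_left algebra_simps)

text \<open>The condition \<open>some_lam\<close> makes \<open>f\<close> strictly positive on
  nonnegative arguments, so that \<open>1 / f\<close> is a genuine reciprocal and not the default
  value of division by zero.\<close>

locale no_purchase_types =
  fixes G :: "'g set" and lam w0 :: "'g \<Rightarrow> real"
  assumes finite_G: "finite G"
    and lam_nonneg: "\<And>g. g \<in> G \<Longrightarrow> lam g \<ge> 0"
    and w0_pos: "\<And>g. g \<in> G \<Longrightarrow> w0 g > 0"
    and some_lam: "\<exists>g\<in>G. lam g \<noteq> 0"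
begin

abbreviation "f \<equiv> attraction G lam w0"

lemma attraction_pos:
  assumes "x \<ge> 0"
  shows "f x > 0"
proof -
  obtain g where g: "g \<in> G" "lam g \<noteq> 0" using some_lam by blast
  have "lam g > 0" "w0 g + x > 0"
    using g lam_nonneg[of g] w0_pos[of g] assms by auto
  moreover have "lam k / (w0 k + x) \<ge> 0" if "k \<in> G" for k
    using that lam_nonneg[of k] w0_pos[of k] assms by simp
  ultimately show ?thesis
    unfolding attraction_def using g finite_G by (intro sum_pos2[of _ g]) auto
qed

lemma attraction_antimono:
  assumes "0 \<le> x" "x \<le> y"
  shows "f y \<le> f x"
  unfolding attraction_def
proof (rule sum_mono)
  fix g assume "g \<in> G"
  then show "lam g / (w0 g + y) \<le> lam g / (w0 g + x)"
    using lam_nonneg[of g] w0_pos[of g] assms by (intro divide_left_mono mult_pos_pos) auto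
qed

text \<open>Cauchy-Schwarz gives \<open>(f x)\<^sup>2 \<le> f y * ?Q\<close> with \<open>?Q\<close>
  affine in \<open>y\<close>; dividing by \<open>f y\<close> and \<open>(f x)\<^sup>2\<close> bounds
  \<open>1 / f y\<close> by the tangent line at \<open>x\<close>.\<close>

lemma inverse_attraction_tangent:
  assumes x: "x \<ge> 0"
  obtains m where "\<And>y. y \<ge> 0 \<Longrightarrow> 1 / f y \<le> 1 / f x + m * (y - x)"
proof
  \<comment> \<open>The derivative of \<open>1 / f\<close> at \<open>x\<close>.\<close>
  let ?m = "(\<Sum>g\<in>G. lam g / (w0 g + x)\<^sup>2) / (f x)\<^sup>2"
  fix y :: real assume y: "y \<ge> 0"
  have u: "w0 g + x > 0" "w0 g + y > 0" if "g \<in> G" for g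
    using that w0_pos[of g] x y by auto
  let ?Q = "\<Sum>g\<in>G. lam g * (w0 g + y) / (w0 g + x)\<^sup>2"
  \<comment> \<open>Each \<open>lam g / (w0 g + x)\<close> is split so that the squares of the first
    factors sum to \<open>f y\<close> and those of the second to \<open>?Q\<close>.\<close>
  have "(\<Sum>g\<in>G. sqrt (lam g / (w0 g + y)) * (sqrt (lam g * (w0 g + y)) / (w0 g + x)))\<^sup>2
      \<le> (\<Sum>g\<in>G. (sqrt (lam g / (w0 g + y)))\<^sup>2) * (\<Sum>g\<in>G. (sqrt (lam g * (w0 g + y)) / (w0 g + x))\<^sup>2)"
    by (rule Cauchy_Schwarz_ineq_sum)
  also have "(\<Sum>g\<in>G. sqrt (lam g / (w0 g + y)) * (sqrt (lam g * (w0 g + y)) / (w0 g + x))) = f x"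
    unfolding attraction_def
  proof (rule sum.cong)
    fix g assume g: "g \<in> G"
    have "sqrt (lam g / (w0 g + y)) * sqrt (lam g * (w0 g + y)) = lam g"
      using u[OF g] lam_nonneg[OF g] by (simp flip: real_sqrt_mult)
    then show "sqrt (lam g / (w0 g + y)) * (sqrt (lam g * (w0 g + y)) / (w0 g + x)) = lam g / (w0 g + x)"
      by simp
  qed simp
  also have "(\<Sum>g\<in>G. (sqrt (lam g / (w0 g + y)))\<^sup>2) = f y"
    unfolding attraction_def using u lam_nonneg by (intro sum.cong) (auto simp: less_imp_le)
  also have "(\<Sum>g\<in>G. (sqrt (lam g * (w0 g + y)) / (w0 g + x))\<^sup>2) = ?Q"
    using u lam_nonneg by (intro sum.cong) (auto simp: less_imp_le power_divide)
  also have "?Q = f x + (\<Sum>g\<in>G. lam g / (w0 g + x)\<^sup>2) * (y - x)"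
    unfolding attraction_def sum_distrib_right sum.distrib[symmetric]
  proof (rule sum.cong)
    fix g assume g: "g \<in> G"
    show "lam g * (w0 g + y) / (w0 g + x)\<^sup>2
      = lam g / (w0 g + x) + lam g / (w0 g + x)\<^sup>2 * (y - x)"
      using u(1)[OF g] by (simp add: divide_simps power2_eq_square) (simp add: algebra_simps)
  qed simp
  finally show "1 / f y \<le> 1 / f x + ?m * (y - x)"
    using attraction_pos[OF x] attraction_pos[OF y]
    by (simp add: divide_simps power2_eq_square) (simp add: algebra_simps)
qed

text \<open>The tangent bound at the convex combination \<open>z\<close> is averaged over
  \<open>x\<close> and \<open>y\<close>; the slope terms cancel.\<close>

lemma inverse_attraction_concave: "concave_on {0..} (\<lambda>x. 1 / f x)"
  unfolding concave_on_iff
proof (intro conjI ballI allI impI)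
  fix x y u v :: real
  assume xy: "x \<in> {0..}" "y \<in> {0..}" and uv: "u \<ge> 0" "v \<ge> 0" "u + v = 1"
  define z where "z = u * x + v * y"
  have "z \<ge> 0" using xy uv by (simp add: z_def)
  then obtain m where m: "\<And>y. y \<ge> 0 \<Longrightarrow> 1 / f y \<le> 1 / f z + m * (y - z)"
    using inverse_attraction_tangent by blast
  have "u * (1 / f x) + v * (1 / f y) \<le> u * (1 / f z + m * (x - z)) + v * (1 / f z + m * (y - z))"
    using xy uv by (intro add_mono mult_left_mono m) auto
  also have "\<dots> = (u + v) * (1 / f z) + m * (u * x + v * y - (u + v) * z)"
    unfolding divide_inverse by (simp add: algebra_simps)
  also have "\<dots> = 1 / f z" using uv by (simp add: z_def)
  finally show "u * (1 / f x) + v * (1 / f y) \<le> 1 / f (u *\<^sub>R x + v *\<^sub>R y)" by (simp add: z_def)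
qed simp

text \<open>Unless \<open>b + d = a\<close>, both \<open>a + d\<close> and \<open>b\<close> are
  convex combinations of \<open>a\<close> and \<open>b + d\<close>, with interchanged weights; the
  sum of the two concavity inequalities is the claim rearranged.\<close>

lemma inverse_attraction_diminishing:
  assumes "0 \<le> a" "a \<le> b" "0 \<le> d"
  shows "1 / f (b + d) - 1 / f b \<le> 1 / f (a + d) - 1 / f a"
proof (cases "b + d = a")
  case False
  define t where "t = d / (b + d - a)"
  have t: "0 \<le> t" "t \<le> 1" using assms False by (auto simp: t_def divide_simps)
  have td: "t * (b + d - a) = d" using False by (simp add: t_def)
  have *: "(1 - s) * (1 / f a) + s * (1 / f (b + d)) \<le> 1 / f ((1 - s) * a + s * (b + d))"
    if "0 \<le> s" "s \<le> 1" for s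
    using inverse_attraction_concave assms that unfolding concave_on_iff by auto
  have e: "(1 - t) * a + t * (b + d) = a + d" "(1 - (1 - t)) * a + (1 - t) * (b + d) = b"
    using td by (auto simp: algebra_simps)
  have "(1 - t) * (1 / f a) + t * (1 / f (b + d)) + ((1 - (1 - t)) * (1 / f a) + (1 - t) * (1 / f (b + d)))
    \<le> 1 / f (a + d) + 1 / f b"
    using *[of t] *[of "1 - t"] t unfolding e by (intro add_mono) auto
  moreover have "(1 - t) * p + t * q + ((1 - (1 - t)) * p + (1 - t) * q) = p + q" for p q :: real
    by (simp add: algebra_simps)
  ultimately show ?thesis by (simp only:)
qed (use assms in auto)

text \<open>
  Depleting inventories proportional to \<open>w\<close> on \<open>A\<close>, at one unit per weight, takes time
  \<open>1 / f (sum w A)\<close>; depleting nothing takes time \<open>0\<close>, not \<open>1 / f 0\<close>.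
\<close>

definition depletion_cost :: "('i \<Rightarrow> real) \<Rightarrow> 'i set \<Rightarrow> real"
  where "depletion_cost w A = (if A = {} then 0 else 1 / f (sum w A))"

section \<open>Monotonicity and submodularity of the depletion cost\<close>

lemma depletion_cost_mono:
  assumes fin: "finite B" and w: "\<And>j. j \<in> B \<Longrightarrow> w j \<ge> 0" and AB: "A \<subseteq> B"
  shows "depletion_cost w A \<le> depletion_cost w B"
proof -
  have 0: "0 \<le> sum w A" "0 \<le> sum w B" using w AB by (auto intro!: sum_nonneg)
  have "sum w A \<le> sum w B" using assms by (intro sum_mono2) auto
  then have "f (sum w B) \<le> f (sum w A)" using 0 by (intro attraction_antimono)
  then have "1 / f (sum w A) \<le> 1 / f (sum w B)"
    using attraction_pos 0 by (simp add: frac_le)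
  then show ?thesis
    using AB attraction_pos[OF 0(2)] by (auto simp: depletion_cost_def)
qed

text \<open>For nonempty \<open>A\<close> these are the diminishing increments of
  \<open>1 / f\<close>. Lowering the value at the empty set from \<open>1 / f 0\<close> to
  \<open>0\<close> only enlarges the right-hand increment, and \<open>B\<close> empty forces
  \<open>A\<close> empty, where both sides agree.\<close>

lemma depletion_cost_submodular:
  assumes fin: "finite B" and w: "\<And>j. j \<in> insert k B \<Longrightarrow> w j \<ge> 0"
    and AB: "A \<subseteq> B" and k: "k \<notin> B"
  shows "depletion_cost w (insert k B) - depletion_cost w B
    \<le> depletion_cost w (insert k A) - depletion_cost w A"
proof -
  have finA: "finite A" "k \<notin> A" using AB fin k finite_subset by auto
  have 0: "0 \<le> sum w A" using w AB by (intro sum_nonneg) auto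
  have le: "sum w A \<le> sum w B" using assms by (intro sum_mono2) auto
  have sums: "sum w (insert k A) = sum w A + w k" "sum w (insert k B) = sum w B + w k"
    using finA fin k by (auto simp: add.commute)
  have "1 / f (sum w B + w k) - 1 / f (sum w B) \<le> 1 / f (sum w A + w k) - 1 / f (sum w A)"
    using 0 le w by (intro inverse_attraction_diminishing) auto
  moreover have "1 / f (sum w A) > 0" using attraction_pos[OF 0] by simp
  moreover have "(if A = {} then 0 else p) \<le> p" if "p > 0" for p :: real
    using that by simp
  ultimately have "1 / f (sum w (insert k B)) - 1 / f (sum w B)
      \<le> 1 / f (sum w (insert k A)) - (if A = {} then 0 else 1 / f (sum w A))"
    unfolding sums by (meson diff_left_mono order_trans)
  then show ?thesis
    using AB by (cases "B = {}") (auto simp: depletion_cost_def)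
qed

end

section \<open>Depletion of the fluid process by time \<open>T\<close>\<close>

context
  fixes N :: "'i set" and G :: "'g set" and lam w0 :: "'g \<Rightarrow> real" and w :: "'i \<Rightarrow> real"
  assumes fin: "finite N"
    and G: "finite G"
    and lam: "\<And>g. g \<in> G \<Longrightarrow> lam g \<ge> 0"
    and w: "\<And>i. i \<in> N \<Longrightarrow> w i > 0"
    and w0: "\<And>g. g \<in> G \<Longrightarrow> w0 g > 0"
begin

abbreviation (input) "\<pi> \<equiv> mixed_np_mnl G lam w w0"

lemma \<pi>_nonneg: "A \<subseteq> N \<Longrightarrow> i \<in> N \<Longrightarrow> \<pi> i A \<ge> 0"
  by (rule mixed_np_mnl_nonneg[OF fin]) (use lam w w0 in auto)

lemma \<pi>_zero: "A \<subseteq> N \<Longrightarrow> i \<in> N - A \<Longrightarrow> \<pi> i A = 0"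
  by (simp add: mixed_np_mnl_notin)

text \<open>By contradiction: a product left at \<open>T\<close> keeps the display nonempty on
  \<open>{0..T}\<close>, so the potential falls by exactly \<open>T\<close>, which is at least its
  starting value. It is then zero at \<open>T\<close>, so \<open>y\<close> vanishes on
  \<open>D T\<close>, although \<open>sum y (D T) = ?\<gamma> (D T)\<close> is positive.\<close>

lemma fluid_show_all_depleted:
  assumes h: "\<And>A. A \<in> Pow N \<Longrightarrow> h A \<ge> 0" and T: "T = (\<Sum>A\<in>Pow N. h A)"
    and \<phi>: "\<And>j. \<phi> j = (\<Sum>A\<in>Pow N. h A * \<pi> j A)"
    and x: "fluid_show_all N \<pi> \<phi> x" and i: "i \<in> N"
  shows "x T i = 0"
proof (rule ccontr)
  assume ne: "x T i \<noteq> 0"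
  have T0: "T \<ge> 0" unfolding T using h by (rule sum_nonneg)
  have init: "\<phi> j \<ge> 0" if "j \<in> N" for j
    unfolding \<phi> using h \<pi>_nonneg that by (intro sum_nonneg mult_nonneg_nonneg) auto
  have antimono: "x t j \<le> x s j" if "j \<in> N" "0 \<le> s" "s \<le> t" for j s t
    by (rule fluid_show_all_antimono[OF fin \<pi>_nonneg \<pi>_zero init x that])
  have nonneg: "x t j \<ge> 0" if "j \<in> N" "0 \<le> t" for j t
    by (rule fluid_show_all_nonneg[OF fin \<pi>_nonneg \<pi>_zero init x that])
  have at_0: "x 0 j = \<phi> j" if "j \<in> N" for j
    by (rule fluid_show_all_0[OF fin \<pi>_nonneg \<pi>_zero init x that])
  have pos: "x T i > 0" using ne nonneg[OF i T0] by simp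
  have "\<phi> i > 0" using pos antimono[of i 0 T] at_0[of i] i T0 by simp
  \<comment> \<open>If all \<open>lam g\<close> vanished, so would every choice probability and
    hence \<open>\<phi> i\<close>; this supplies \<open>some_lam\<close>.\<close>
  then have "\<exists>g\<in>G. lam g \<noteq> 0"
    by (rule contrapos_pp) (simp add: \<phi> mixed_np_mnl_def sum.neutral)
  then interpret no_purchase_types G lam w0
    using G lam w0 by unfold_locales
  define D where "D t = displayed N (x t)" for t
  have DN: "D t \<subseteq> N" for t by (auto simp: D_def displayed_def)
  have D_anti: "D t \<subseteq> D s" if "0 \<le> s" "s \<le> t" for s t
    using antimono[OF _ that] by (force simp: D_def displayed_def)
  have "i \<in> D T" using i pos by (simp add: D_def displayed_def)
  then have Dne: "D t \<noteq> {}" if "t \<in> {0..T}" for t using that D_anti[of t T] by auto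
  let ?\<gamma> = "depletion_cost w"
  have w': "w j \<ge> 0" if "j \<in> N" for j using w[OF that] by simp
  have "\<exists>y. (\<forall>j\<in>N. y j \<ge> 0) \<and> (\<forall>A\<subseteq>N. sum y A \<le> ?\<gamma> A) \<and> (\<forall>X\<in>D ` {0..T}. sum y X = ?\<gamma> X)"
  proof (rule submodular_greedy_chain[OF fin])
    show "?\<gamma> A \<le> ?\<gamma> B" if "A \<subseteq> B" "B \<subseteq> N" for A B
      using that fin w' by (intro depletion_cost_mono) (auto intro: finite_subset)
    show "?\<gamma> (insert k B) - ?\<gamma> B \<le> ?\<gamma> (insert k A) - ?\<gamma> A"
      if "A \<subseteq> B" "B \<subseteq> N" "k \<in> N - B" for A B k
      using that fin w' by (intro depletion_cost_submodular) (auto intro: finite_subset)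
    show "X \<subseteq> Y \<or> Y \<subseteq> X" if XY: "X \<in> D ` {0..T}" "Y \<in> D ` {0..T}" for X Y
    proof -
      from XY obtain s t where st: "X = D s" "Y = D t" "0 \<le> s" "0 \<le> t" by auto
      show ?thesis
        unfolding st(1,2) using linear[of s t] D_anti[OF st(3)] D_anti[OF st(4)] by metis
    qed
  qed (use DN in \<open>auto simp: depletion_cost_def\<close>)
  then obtain y where "(\<forall>j\<in>N. y j \<ge> 0) \<and> (\<forall>A\<subseteq>N. sum y A \<le> ?\<gamma> A) \<and>
    (\<forall>X\<in>D ` {0..T}. sum y X = ?\<gamma> X)" ..
  then have y: "\<And>j. j \<in> N \<Longrightarrow> y j \<ge> 0" "\<And>A. A \<subseteq> N \<Longrightarrow> sum y A \<le> ?\<gamma> A"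
    "\<And>t. t \<in> {0..T} \<Longrightarrow> sum y (D t) = ?\<gamma> (D t)" by simp_all
  \<comment> \<open>Dividing by \<open>w j\<close> cancels the product weight in
    \<open>\<pi> j A\<close>, leaving the common factor \<open>f (sum w A)\<close>.\<close>
  have rate: "(\<Sum>j\<in>N. y j / w j * \<pi> j A) = f (sum w A) * sum y A" if "A \<subseteq> N" for A
  proof -
    have "(\<Sum>j\<in>N. y j / w j * \<pi> j A) = (\<Sum>j\<in>A. y j / w j * \<pi> j A)"
      using that fin \<pi>_zero by (intro sum.mono_neutral_right) auto
    also have "\<dots> = (\<Sum>j\<in>A. f (sum w A) * y j)"
      using that w by (intro sum.cong) (force simp: mixed_np_mnl_attraction)+
    finally show ?thesis by (simp add: sum_distrib_left)
  qed
  have f\<gamma>: "f (sum w A) * ?\<gamma> A = 1" "f (sum w A) > 0" if "A \<subseteq> N" "A \<noteq> {}" for A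
  proof -
    have "sum w A \<ge> 0" using that w' by (intro sum_nonneg) auto
    then show "f (sum w A) * ?\<gamma> A = 1" "f (sum w A) > 0"
      using attraction_pos[of "sum w A"] that by (auto simp: depletion_cost_def)
  qed
  \<comment> \<open>Each nonempty \<open>A\<close> adds at most
    \<open>f (sum w A) * ?\<gamma> A = 1\<close> per unit of \<open>h A\<close>; the empty set adds
    \<open>0\<close>.\<close>
  have start: "(\<Sum>j\<in>N. y j / w j * \<phi> j) \<le> T"
  proof -
    have "(\<Sum>j\<in>N. y j / w j * \<phi> j) = (\<Sum>A\<in>Pow N. h A * (\<Sum>j\<in>N. y j / w j * \<pi> j A))"
      unfolding \<phi> sum_distrib_left by (subst sum.swap) (simp add: algebra_simps)
    also have "\<dots> \<le> (\<Sum>A\<in>Pow N. h A * 1)"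
    proof (intro sum_mono mult_left_mono h)
      fix A assume "A \<in> Pow N"
      then have A: "A \<subseteq> N" by simp
      show "(\<Sum>j\<in>N. y j / w j * \<pi> j A) \<le> 1"
      proof (cases "A = {}")
        case False
        then show ?thesis
          unfolding rate[OF A] using f\<gamma>[OF A] y(2)[OF A] mult_left_mono[of "sum y A" "?\<gamma> A" "f (sum w A)"]
          by simp
      qed (simp add: mixed_np_mnl_notin)
    qed
    finally show ?thesis by (simp add: T)
  qed
  \<comment> \<open>The drop of the potential over \<open>{0..T}\<close> is computed twice: from the
    inventories, and from the constant rate \<open>1\<close>.\<close>
  have "((\<lambda>s. \<Sum>j\<in>N. y j / w j * \<pi> j (D s)) has_integral (\<Sum>j\<in>N. y j / w j * (\<phi> j - x T j))) {0..T}"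
    using x T0 fin unfolding fluid_show_all_def D_def
    by (intro has_integral_sum has_integral_mult_right) auto
  moreover have "((\<lambda>s. \<Sum>j\<in>N. y j / w j * \<pi> j (D s)) has_integral T) {0..T}"
  proof (rule has_integral_eq)
    show "((\<lambda>_. 1) has_integral T) {0..T}"
      using has_integral_const_real[of "1::real" 0 T] T0 by simp
    show "1 = (\<Sum>j\<in>N. y j / w j * \<pi> j (D s))" if "s \<in> {0..T}" for s
      using f\<gamma>[OF DN Dne] y(3) rate[OF DN] that by simp
  qed
  ultimately have "(\<Sum>j\<in>N. y j / w j * (\<phi> j - x T j)) = T" by (rule has_integral_unique)
  then have "(\<Sum>j\<in>N. y j / w j * x T j) \<le> 0"
    using start by (simp add: right_diff_distrib sum_subtractf)
  moreover have terms: "y j / w j * x T j \<ge> 0" if "j \<in> N" for j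
    using y(1) w' nonneg T0 that by simp
  ultimately have "(\<Sum>j\<in>N. y j / w j * x T j) = 0" by (intro antisym sum_nonneg)
  then have zero: "y j / w j * x T j = 0" if "j \<in> N" for j
    using sum_nonneg_eq_0_iff[OF fin, of "\<lambda>j. y j / w j * x T j"] terms that by blast
  \<comment> \<open>Both \<open>w j\<close> and \<open>x T j\<close> are positive on
    \<open>D T\<close>, so the vanishing term leaves only \<open>y j = 0\<close>.\<close>
  have "y j = 0" if "j \<in> D T" for j
    using that zero[of j] w[of j] by (auto simp: D_def displayed_def)
  then have "sum y (D T) = 0" by simp
  then show False using y(3)[of T] f\<gamma>[OF DN Dne, of T] T0 by simp
qed

lemma mixed_np_mnl_CCD: "CCD N \<pi>"
  unfolding CCD_def
proof (intro allI impI ballI)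
  fix T :: real and h i
  assume hT: "(\<forall>A\<in>Pow N. h A \<ge> 0) \<and> (\<Sum>A\<in>Pow N. h A) = T" and i: "i \<in> N"
  define \<phi> where "\<phi> = (\<lambda>j. \<Sum>A\<in>Pow N. h A * \<pi> j A)"
  have "\<exists>x. fluid_show_all N \<pi> \<phi> x"
    using hT \<pi>_nonneg \<pi>_zero fin
    by (intro fluid_show_all_exists) (auto simp: \<phi>_def intro!: sum_nonneg)
  then have "fluid_show_all N \<pi> \<phi> (fluid_inventory N \<pi> \<phi>)"
    unfolding fluid_inventory_def by (rule someI_ex)
  then have "fluid_inventory N \<pi> \<phi> T i = 0"
    using hT i by (intro fluid_show_all_depleted[of h T \<phi>]) (auto simp: \<phi>_def)
  moreover have "T \<ge> 0" using hT by (auto intro: sum_nonneg)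
  \<comment> \<open>\<open>T\<close> is one of the times of zero inventory, which bounds the infimum
    from above; all these times are nonnegative.\<close>
  ultimately show "stockout_time N \<pi> (\<lambda>j. \<Sum>A\<in>Pow N. h A * \<pi> j A) i \<in> {0..ereal T}"
    unfolding \<phi>_def[symmetric] stockout_time_def
    by (auto intro!: INF_greatest INF_lower)
qed

end

theorem lemma1:
  fixes n :: nat
    and G :: "'g set" and lam :: "'g \<Rightarrow> real"
    and w :: "nat \<Rightarrow> real" and w0 :: "'g \<Rightarrow> real"
  assumes "finite G"
    and "\<And>g. g \<in> G \<Longrightarrow> lam g \<ge> 0"
    and "(\<Sum>g\<in>G. lam g) \<le> 1"
    and "\<And>i. i \<in> {1..n} \<Longrightarrow> w i > 0"
    and "\<And>g. g \<in> G \<Longrightarrow> w0 g > 0"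
  shows "CCD {1..n} (mixed_np_mnl G lam w w0)"
  using assms by (intro mixed_np_mnl_CCD) auto

end
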